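(* Let $\mu_1,\mu_2\in\mathbb{R}$ and let $\sigma_1,\sigma_2>0$ be real numbers. Then $$\frac{1}{200}\min\left\{1,\max\left\{\frac{|\sigma_1^2-\sigma_2^2|}{\sigma_1^2},\frac{40|\mu_1-\mu_2|}{\sigma_1}\right\}\right\}\leq \operatorname{TV}\left(\mathcal{N}(\mu_1,\sigma_1^2),\mathcal{N}(\mu_2,\sigma_2^2)\right)\leq \frac{3|\sigma_1^2-\sigma_2^2|}{2\sigma_1^2}+\frac{|\mu_1-\mu_2|}{2\sigma_1}.$$
   Context: For probability distributions $P,Q$ on $\mathbb{R}$, the total variation distance is $\operatorname{TV}(P,Q)=\sup_{A}|P(A)-Q(A)|$, the supremum being over (Borel) sets $A\subseteq\mathbb{R}$. $\mathcal{N}(\mu,\sigma^2)$ is the Gaussian distribution on $\mathbb{R}$ with mean $\mu$ and variance $\sigma^2$. *)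

theory Defs
  imports "HOL-Probability.Probability"
begin

definition total_variation :: "real measure \<Rightarrow> real measure \<Rightarrow> real" where
  "total_variation P Q = (SUP A \<in> sets borel. \<bar>measure P A - measure Q A\<bar>)"

(* As in normal_density, the second argument is the standard deviation, not the variance:
   gaussian \<mu> \<sigma> is N(\<mu>, \<sigma>\<^sup>2). *)
definition gaussian :: "real \<Rightarrow> real \<Rightarrow> real measure" where
  "gaussian \<mu> \<sigma> = density lborel (normal_density \<mu> \<sigma>)"

end

theory Submission
  imports Defs
begin

text \<open>
  The lower bound only tests half-lines: with \<open>\<Phi>\<close> the standard normal distribution function, every
  threshold \<open>t\<close> gives \<open>TV \<ge> \<bar>\<Phi> ((t - \<mu>\<^sub>1) / \<sigma>\<^sub>1) - \<Phi> ((t - \<mu>\<^sub>2) / \<sigma>\<^sub>2)\<bar>\<close>, and \<open>\<Phi>\<close> has slope at least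
  \<open>1/5\<close> on \<open>[-1, 1]\<close>. The threshold \<open>t = \<mu>\<^sub>2\<close> detects the means whatever the variances are. To
  detect the variances, take \<open>t\<close> one standard deviation of the narrower distribution away from its
  mean, on the side that makes the difference of the means help.

  The upper bound goes through \<open>N(\<mu>\<^sub>2, \<sigma>\<^sub>1\<^sup>2)\<close>. Two Gaussians of the same variance have
  densities that cross only at the midpoint of the means, so the half-line ending there attains the
  supremum. For two Gaussians of the same mean and standard deviations \<open>s \<le> t\<close>, the narrow density
  is at most \<open>t/s\<close> times the wide one, which bounds the distance by \<open>1 - s/t\<close>.
\<close>

section \<open>Gaussians as probability measures on the Borel sets\<close>

lemma sets_gaussian [simp, measurable_cong]: "sets (gaussian \<mu> \<sigma>) = sets borel"
  by (simp add: gaussian_def)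

lemma space_gaussian [simp]: "space (gaussian \<mu> \<sigma>) = UNIV"
  by (simp add: gaussian_def)

lemma prob_space_gaussian: "\<sigma> > 0 \<Longrightarrow> prob_space (gaussian \<mu> \<sigma>)"
  unfolding gaussian_def by (rule prob_space_normal_density)

lemma real_distribution_gaussian: "\<sigma> > 0 \<Longrightarrow> real_distribution (gaussian \<mu> \<sigma>)"
  by (simp add: real_distribution_def real_distribution_axioms_def prob_space_gaussian)

section \<open>Total variation distance of probability measures\<close>

lemma total_variation_ge:
  assumes "prob_space P" "prob_space Q" "A \<in> sets borel"
  shows "\<bar>measure P A - measure Q A\<bar> \<le> total_variation P Q"
  unfolding total_variation_def
proof (rule cSUP_upper[OF assms(3)])
  \<comment> \<open>A real supremum dominates its family only if the family is bounded above;
    differences of probabilities stay within 1.\<close>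
  show "bdd_above ((\<lambda>A. \<bar>measure P A - measure Q A\<bar>) ` sets borel)"
  proof (rule bdd_aboveI2[where M = 1])
    fix B
    show "\<bar>measure P B - measure Q B\<bar> \<le> 1"
      using prob_space.prob_le_1[OF assms(1), of B] prob_space.prob_le_1[OF assms(2), of B]
        measure_nonneg[of P B] measure_nonneg[of Q B] by linarith
  qed
qed

lemma total_variation_le:
  assumes "\<And>A. A \<in> sets borel \<Longrightarrow> \<bar>measure P A - measure Q A\<bar> \<le> c"
  shows "total_variation P Q \<le> c"
  unfolding total_variation_def by (rule cSUP_least) (use assms in auto)

lemma total_variation_commute: "total_variation P Q = total_variation Q P"
  unfolding total_variation_def by (simp add: abs_minus_commute)

lemma total_variation_triangle:
  assumes "prob_space P" "prob_space Q" "prob_space R"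
  shows "total_variation P R \<le> total_variation P Q + total_variation Q R"
proof (rule total_variation_le)
  fix A :: "real set" assume "A \<in> sets borel"
  then show "\<bar>measure P A - measure R A\<bar> \<le> total_variation P Q + total_variation Q R"
    using total_variation_ge[OF assms(1,2), of A] total_variation_ge[OF assms(2,3), of A]
    by linarith
qed

text \<open>Both measures have total mass 1, so passing to the complement flips the sign of the
  difference. This removes the absolute value from the upper bounds below.\<close>

lemma total_variation_le_one_sided:
  assumes "prob_space P" "prob_space Q" "sets P = sets borel" "sets Q = sets borel"
    and le: "\<And>A. A \<in> sets borel \<Longrightarrow> measure P A - measure Q A \<le> c"
  shows "total_variation P Q \<le> c"
proof (rule total_variation_le)
  fix A :: "real set" assume A: "A \<in> sets borel"
  have "space P = UNIV" "space Q = UNIV"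
    using assms(3,4)[THEN sets_eq_imp_space_eq] by simp_all
  then have "measure P (- A) = 1 - measure P A" "measure Q (- A) = 1 - measure Q A"
    using prob_space.prob_compl[OF assms(1), of A] prob_space.prob_compl[OF assms(2), of A]
      A assms(3,4) by (simp_all add: Compl_eq_Diff_UNIV)
  moreover have "- A \<in> sets borel"
    using A by (rule borel_comp)
  ultimately show "\<bar>measure P A - measure Q A\<bar> \<le> c"
    using le[OF A] le[of "- A"] by linarith
qed

section \<open>Comparing Gaussians through their densities\<close>

lemma emeasure_gaussian:
  "A \<in> sets borel \<Longrightarrow>
    emeasure (gaussian \<mu> \<sigma>) A = (\<integral>\<^sup>+x. ennreal (normal_density \<mu> \<sigma> x) * indicator A x \<partial>lborel)"
  unfolding gaussian_def by (simp add: emeasure_density)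

text \<open>Integrates a pointwise comparison over \<open>A\<close>. The factor is
  \<open>c = 1\<close> when the variances agree and \<open>c = \<sigma> / \<tau>\<close> when the
  means agree.\<close>

lemma measure_gaussian_mono:
  assumes "\<sigma> > 0" "\<tau> > 0" "c \<ge> 0" and A: "A \<in> sets borel"
    and le: "\<And>x. x \<in> A \<Longrightarrow> c * normal_density \<mu> \<sigma> x \<le> normal_density \<nu> \<tau> x"
  shows "c * measure (gaussian \<mu> \<sigma>) A \<le> measure (gaussian \<nu> \<tau>) A"
proof -
  interpret P: prob_space "gaussian \<mu> \<sigma>" using assms by (intro prob_space_gaussian)
  interpret Q: prob_space "gaussian \<nu> \<tau>" using assms by (intro prob_space_gaussian)
  have "ennreal c * emeasure (gaussian \<mu> \<sigma>) A
      = (\<integral>\<^sup>+x. ennreal c * (ennreal (normal_density \<mu> \<sigma> x) * indicator A x) \<partial>lborel)"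
    unfolding emeasure_gaussian[OF A] using A by (intro nn_integral_cmult[symmetric]) auto
  also have "\<dots> \<le> (\<integral>\<^sup>+x. ennreal (normal_density \<nu> \<tau> x) * indicator A x \<partial>lborel)"
    using le assms(3)
    by (intro nn_integral_mono)
       (auto simp: indicator_def ennreal_mult'[symmetric] intro!: ennreal_leI)
  also have "\<dots> = emeasure (gaussian \<nu> \<tau>) A"
    by (rule emeasure_gaussian[OF A, symmetric])
  finally show ?thesis
    using assms(3) by (simp add: P.emeasure_eq_measure Q.emeasure_eq_measure ennreal_mult'[symmetric])
qed

section \<open>The standard normal density and distribution function\<close>

lemma std_normal_density_ge:
  assumes "\<bar>x\<bar> \<le> 1"
  shows "1 / 5 \<le> std_normal_density x"
proof -
  \<comment> \<open>Halving the exponent before using \<open>1 + y \<le> exp y\<close> gives 9/16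
    for \<open>exp (- (1 / 2))\<close>; direct use would give only 1/2.\<close>
  have "(1 - 1 / 4) ^ 2 \<le> (exp (- (1 / 4)) :: real) ^ 2"
    using exp_ge_add_one_self[of "- (1 / 4) :: real"] by (intro power_mono) auto
  also have "\<dots> = exp (- (1 / 2))"
    by (simp add: power2_eq_square flip: exp_add)
  also have "\<dots> \<le> exp (- x\<^sup>2 / 2)"
    using assms by (simp add: abs_square_le_1)
  finally have e: "9 / 16 \<le> exp (- x\<^sup>2 / 2)"
    by (simp add: power2_eq_square)
  \<comment> \<open>The constant 45/16 is five times 9/16, exactly what the quotient 1/5
    requires.\<close>
  have "sqrt (2 * pi) \<le> sqrt ((45 / 16)\<^sup>2)"
    using pi_approx by (intro real_sqrt_le_mono) (auto simp: power2_eq_square)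
  then have s: "sqrt (2 * pi) \<le> 45 / 16" by simp
  have "1 / 5 \<le> (9 / 16) / sqrt (2 * pi)"
    using s by (simp add: field_simps)
  also have "\<dots> \<le> exp (- x\<^sup>2 / 2) / sqrt (2 * pi)"
    using e by (intro divide_right_mono) auto
  finally show ?thesis by (simp add: normal_density_def)
qed

text \<open>The peak is about 0.399. The rounder 1/2 is precisely what produces the coefficient
  \<open>1 / (2 * \<sigma>)\<close> in the bound for the means.\<close>

lemma std_normal_density_le: "std_normal_density x \<le> 1 / 2"
proof -
  have "sqrt (2\<^sup>2) \<le> sqrt (2 * pi)"
    using pi_ge_two by (intro real_sqrt_le_mono) auto
  then have "exp (- x\<^sup>2 / 2) / sqrt (2 * pi) \<le> 1 / 2"
    by (intro frac_le) auto
  then show ?thesis by (simp add: normal_density_def)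
qed

abbreviation std_normal_cdf :: "real \<Rightarrow> real" (\<open>\<Phi>\<close>) where
  "\<Phi> \<equiv> cdf (gaussian 0 1)"

lemma mono_std_normal_cdf: "x \<le> y \<Longrightarrow> \<Phi> x \<le> \<Phi> y"
  by (intro finite_borel_measure.cdf_nondecreasing real_distribution.finite_borel_measure_M
      real_distribution_gaussian) auto

lemma nn_integral_std_normal_density_Ioc:
  assumes "a \<le> b"
  shows "(\<integral>\<^sup>+x. ennreal (std_normal_density x) * indicator {a<..b} x \<partial>lborel)
    = ennreal (\<Phi> b - \<Phi> a)"
proof -
  interpret real_distribution "gaussian 0 1" by (rule real_distribution_gaussian) simp
  show ?thesis
    using assms emeasure_gaussian[of "{a<..b}" 0 1]
    \<comment> \<open>\<open>cdf_diff_eq\<close> needs \<open>a < b\<close>, so the empty interval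
      is treated apart.\<close>
    by (cases "a = b") (simp_all add: emeasure_eq_measure cdf_diff_eq)
qed

lemma nn_integral_const_Ioc:
  fixes a b c :: real
  assumes "a \<le> b" "c \<ge> 0"
  shows "(\<integral>\<^sup>+x. ennreal c * indicator {a<..b} x \<partial>lborel) = ennreal (c * (b - a))"
  using assms by (subst nn_integral_cmult_indicator) (auto simp: ennreal_mult')

lemma std_normal_cdf_diff_ge:
  assumes "-1 \<le> a" "a \<le> b" "b \<le> 1"
  shows "(b - a) / 5 \<le> \<Phi> b - \<Phi> a"
proof -
  have "ennreal ((b - a) / 5) = (\<integral>\<^sup>+x. ennreal (1 / 5) * indicator {a<..b} x \<partial>lborel)"
    using assms by (subst nn_integral_const_Ioc) simp_all
  also have "\<dots> \<le> (\<integral>\<^sup>+x. ennreal (std_normal_density x) * indicator {a<..b} x \<partial>lborel)"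
    using assms ennreal_leI[OF std_normal_density_ge]
    by (intro nn_integral_mono) (auto simp: indicator_def)
  \<comment> \<open>\<open>ennreal\<close> sends negative reals to 0; monotonicity of
    \<open>\<Phi>\<close> makes the difference nonnegative, so the inequality transfers back to the
    reals.\<close>
  finally show ?thesis
    using nn_integral_std_normal_density_Ioc[of a b] mono_std_normal_cdf[of a b] assms by simp
qed

lemma std_normal_cdf_diff_le:
  assumes "a \<le> b"
  shows "\<Phi> b - \<Phi> a \<le> (b - a) / 2"
proof -
  have "ennreal (\<Phi> b - \<Phi> a) = (\<integral>\<^sup>+x. ennreal (std_normal_density x) * indicator {a<..b} x \<partial>lborel)"
    using nn_integral_std_normal_density_Ioc[OF assms] by simp
  also have "\<dots> \<le> (\<integral>\<^sup>+x. ennreal (1 / 2) * indicator {a<..b} x \<partial>lborel)"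
    by (intro nn_integral_mono mult_right_mono ennreal_leI std_normal_density_le) simp
  also have "\<dots> = ennreal ((b - a) / 2)"
    using assms by (subst nn_integral_const_Ioc) simp_all
  finally show ?thesis using assms by simp
qed

text \<open>Standardisation: the identity is a normal variable under
  \<open>gaussian \<mu> \<sigma>\<close>, and its image under \<open>(x - \<mu>) / \<sigma>\<close>
  is standard normal. The preimage of a half-line is again a half-line because \<sigma> is
  positive.\<close>

lemma cdf_gaussian:
  assumes "\<sigma> > 0"
  shows "cdf (gaussian \<mu> \<sigma>) t = \<Phi> ((t - \<mu>) / \<sigma>)"
proof -
  interpret prob_space "gaussian \<mu> \<sigma>" using assms by (rule prob_space_gaussian)
  have "distributed (gaussian \<mu> \<sigma>) lborel (\<lambda>x. x) (normal_density \<mu> \<sigma>)"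
    unfolding distributed_def
    by (auto simp: gaussian_def intro!: measure_eqI simp: emeasure_distr)
  then have "distributed (gaussian \<mu> \<sigma>) lborel (\<lambda>x. (x - \<mu>) / \<sigma>) std_normal_density"
    using normal_standard_normal_convert[OF assms, of "\<lambda>x. x" \<mu>] by simp
  then have "gaussian 0 1 = distr (gaussian \<mu> \<sigma>) lborel (\<lambda>x. (x - \<mu>) / \<sigma>)"
    unfolding distributed_def gaussian_def by simp
  then have "\<Phi> ((t - \<mu>) / \<sigma>)
      = measure (gaussian \<mu> \<sigma>) ((\<lambda>x. (x - \<mu>) / \<sigma>) -` {..(t - \<mu>) / \<sigma>} \<inter> space (gaussian \<mu> \<sigma>))"
    unfolding cdf_def by (simp add: measure_distr)
  also have "(\<lambda>x. (x - \<mu>) / \<sigma>) -` {..(t - \<mu>) / \<sigma>} \<inter> space (gaussian \<mu> \<sigma>) = {..t}"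
    using assms by (auto simp: divide_le_cancel)
  finally show ?thesis unfolding cdf_def by simp
qed

section \<open>Lower bounds from half-lines\<close>

lemma total_variation_gaussian_ge_cdf:
  assumes "\<sigma>\<^sub>1 > 0" "\<sigma>\<^sub>2 > 0"
  shows "\<bar>\<Phi> ((t - \<mu>\<^sub>1) / \<sigma>\<^sub>1) - \<Phi> ((t - \<mu>\<^sub>2) / \<sigma>\<^sub>2)\<bar>
    \<le> total_variation (gaussian \<mu>\<^sub>1 \<sigma>\<^sub>1) (gaussian \<mu>\<^sub>2 \<sigma>\<^sub>2)"
  using total_variation_ge[OF prob_space_gaussian[OF assms(1), of \<mu>\<^sub>1]
      prob_space_gaussian[OF assms(2), of \<mu>\<^sub>2], of "{..t}"]
  unfolding cdf_gaussian[OF assms(1), symmetric] cdf_gaussian[OF assms(2), symmetric]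
  by (simp add: cdf_def)

lemma total_variation_gaussian_ge_mean:
  assumes "\<sigma>\<^sub>1 > 0" "\<sigma>\<^sub>2 > 0"
  shows "min 1 (\<bar>\<mu>\<^sub>1 - \<mu>\<^sub>2\<bar> / \<sigma>\<^sub>1) / 5 \<le> total_variation (gaussian \<mu>\<^sub>1 \<sigma>\<^sub>1) (gaussian \<mu>\<^sub>2 \<sigma>\<^sub>2)"
proof -
  define d where "d = (\<mu>\<^sub>2 - \<mu>\<^sub>1) / \<sigma>\<^sub>1"
  \<comment> \<open>The slope bound holds only on [-1, 1], so \<open>d\<close> is clipped to that
    interval; monotonicity of \<open>\<Phi>\<close> covers the rest.\<close>
  have "min 1 \<bar>d\<bar> / 5 \<le> \<bar>\<Phi> d - \<Phi> 0\<bar>"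
  proof (cases "0 \<le> d")
    case True
    then show ?thesis
      using std_normal_cdf_diff_ge[of 0 "min 1 d"] mono_std_normal_cdf[of "min 1 d" d] by auto
  next
    case False
    then show ?thesis
      using std_normal_cdf_diff_ge[of "max (-1) d" 0] mono_std_normal_cdf[of d "max (-1) d"]
      by (auto simp: min_def max_def split: if_splits)
  qed
  also have "\<bar>\<Phi> d - \<Phi> 0\<bar> \<le> total_variation (gaussian \<mu>\<^sub>1 \<sigma>\<^sub>1) (gaussian \<mu>\<^sub>2 \<sigma>\<^sub>2)"
    using total_variation_gaussian_ge_cdf[OF assms, of \<mu>\<^sub>2 \<mu>\<^sub>1 \<mu>\<^sub>2] by (simp add: d_def)
  finally show ?thesis
    using assms by (simp add: d_def abs_minus_commute)
qed

lemma total_variation_gaussian_ge_sd: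
  assumes "0 < \<sigma>\<^sub>1" "\<sigma>\<^sub>1 \<le> \<sigma>\<^sub>2"
  shows "(1 - \<sigma>\<^sub>1 / \<sigma>\<^sub>2) / 5 \<le> total_variation (gaussian \<mu>\<^sub>1 \<sigma>\<^sub>1) (gaussian \<mu>\<^sub>2 \<sigma>\<^sub>2)"
proof -
  have pos: "\<sigma>\<^sub>2 > 0" using assms by simp
  have q: "0 \<le> \<sigma>\<^sub>1 / \<sigma>\<^sub>2" "\<sigma>\<^sub>1 / \<sigma>\<^sub>2 \<le> 1" using assms by auto
  show ?thesis
  proof (cases "\<mu>\<^sub>1 \<le> \<mu>\<^sub>2")
    case True
    \<comment> \<open>At this threshold the narrow distribution function is \<open>\<Phi> 1\<close>,
      while the wide one is at most \<open>\<Phi>\<close> of the ratio of the standard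
      deviations.\<close>
    have "(\<mu>\<^sub>1 + \<sigma>\<^sub>1 - \<mu>\<^sub>2) / \<sigma>\<^sub>2 \<le> \<sigma>\<^sub>1 / \<sigma>\<^sub>2"
      using True pos by (intro divide_right_mono) auto
    from mono_std_normal_cdf[OF this] show ?thesis
      using total_variation_gaussian_ge_cdf[OF assms(1) pos, of "\<mu>\<^sub>1 + \<sigma>\<^sub>1" \<mu>\<^sub>1 \<mu>\<^sub>2] assms(1)
        std_normal_cdf_diff_ge[of "\<sigma>\<^sub>1 / \<sigma>\<^sub>2" 1] q
      by simp
  next
    case False
    \<comment> \<open>Mirror image: here the narrow distribution function is
      \<open>\<Phi> (-1)\<close> and the wide one is the larger of the two.\<close>
    have "- (\<sigma>\<^sub>1 / \<sigma>\<^sub>2) \<le> (\<mu>\<^sub>1 - \<sigma>\<^sub>1 - \<mu>\<^sub>2) / \<sigma>\<^sub>2"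
      unfolding minus_divide_left using False pos by (intro divide_right_mono) auto
    from mono_std_normal_cdf[OF this] show ?thesis
      using total_variation_gaussian_ge_cdf[OF assms(1) pos, of "\<mu>\<^sub>1 - \<sigma>\<^sub>1" \<mu>\<^sub>1 \<mu>\<^sub>2] assms(1)
        std_normal_cdf_diff_ge[of "-1" "- (\<sigma>\<^sub>1 / \<sigma>\<^sub>2)"] q
      by simp
  qed
qed

text \<open>The normalisation by the first variance is asymmetric, so the first distribution being
  the narrower or the wider one gives two cases, both expressed by the ratio \<open>s\<close> of the
  standard deviations. The constant 30 is 5 times the 6 lost in the first case.\<close>

lemma total_variation_gaussian_ge_variance:
  assumes "\<sigma>\<^sub>1 > 0" "\<sigma>\<^sub>2 > 0"
  shows "min 1 (\<bar>\<sigma>\<^sub>1\<^sup>2 - \<sigma>\<^sub>2\<^sup>2\<bar> / \<sigma>\<^sub>1\<^sup>2) / 30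
    \<le> total_variation (gaussian \<mu>\<^sub>1 \<sigma>\<^sub>1) (gaussian \<mu>\<^sub>2 \<sigma>\<^sub>2)"
proof -
  define s where "s = \<sigma>\<^sub>2 / \<sigma>\<^sub>1"
  have s: "s > 0" using assms by (simp add: s_def)
  have "(\<sigma>\<^sub>1\<^sup>2 - \<sigma>\<^sub>2\<^sup>2) / \<sigma>\<^sub>1\<^sup>2 = 1 - s\<^sup>2"
    using assms by (simp add: s_def field_simps)
  then have eq: "\<bar>\<sigma>\<^sub>1\<^sup>2 - \<sigma>\<^sub>2\<^sup>2\<bar> / \<sigma>\<^sub>1\<^sup>2 = \<bar>1 - s\<^sup>2\<bar>"
    by (metis abs_divide abs_power2)
  have fac: "1 - s\<^sup>2 = (1 - s) * (1 + s)"
    by (simp add: power2_eq_square algebra_simps)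
  show ?thesis
  proof (cases "\<sigma>\<^sub>1 \<le> \<sigma>\<^sub>2")
    case True
    then have s1: "s \<ge> 1" using assms by (simp add: s_def)
    \<comment> \<open>For \<open>s \<le> 2\<close>, the factor 6 is 3 from
      \<open>1 + s \<le> 3\<close> times 2 from dividing by \<open>s\<close>. For larger
      \<open>s\<close> the right side is already at least 1/2, and the left side is capped at
      1/6.\<close>
    have "min 1 \<bar>1 - s\<^sup>2\<bar> / 6 \<le> 1 - 1 / s"
    proof (cases "s \<le> 2")
      case True
      have "\<bar>1 - s\<^sup>2\<bar> = (s - 1) * (1 + s)"
        unfolding fac abs_mult using s1 by simp
      also have "\<dots> \<le> (s - 1) * 3"
        using True s1 by (intro mult_left_mono) auto
      finally have "min 1 \<bar>1 - s\<^sup>2\<bar> \<le> (s - 1) * 3"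
        by (rule min.coboundedI2)
      then have "min 1 \<bar>1 - s\<^sup>2\<bar> / 6 \<le> (s - 1) / 2" by simp
      also have "\<dots> \<le> (s - 1) / s"
        using True s1 by (intro divide_left_mono) auto
      finally show ?thesis using s1 by (simp add: diff_divide_distrib)
    next
      case False
      then have "1 / s \<le> 1 / 2" by (intro divide_left_mono) auto
      then show ?thesis by (auto simp: min_def)
    qed
    moreover have "1 / s = \<sigma>\<^sub>1 / \<sigma>\<^sub>2" by (simp add: s_def)
    ultimately show ?thesis
      unfolding eq using total_variation_gaussian_ge_sd[OF assms(1) True, of \<mu>\<^sub>1 \<mu>\<^sub>2] by simp
  next
    case False
    then have s1: "s \<le> 1" using assms by (simp add: s_def)
    have "\<bar>1 - s\<^sup>2\<bar> = (1 - s) * (1 + s)"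
      unfolding fac abs_mult using s1 s by simp
    also have "\<dots> \<le> (1 - s) * 2"
      using s1 by (intro mult_left_mono) auto
    finally have "min 1 \<bar>1 - s\<^sup>2\<bar> \<le> (1 - s) * 2"
      by (rule min.coboundedI2)
    then have "min 1 \<bar>1 - s\<^sup>2\<bar> / 30 \<le> (1 - s) / 5"
      using s1 by simp
    also have "\<dots> \<le> total_variation (gaussian \<mu>\<^sub>2 \<sigma>\<^sub>2) (gaussian \<mu>\<^sub>1 \<sigma>\<^sub>1)"
      unfolding s_def using False assms by (intro total_variation_gaussian_ge_sd) auto
    finally show ?thesis
      unfolding eq by (simp add: total_variation_commute)
  qed
qed

section \<open>Upper bounds when only one parameter differs\<close>

lemma total_variation_gaussian_le_sd:
  assumes "0 < \<sigma>" "\<sigma> \<le> \<tau>"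
  shows "total_variation (gaussian \<mu> \<sigma>) (gaussian \<mu> \<tau>) \<le> 1 - \<sigma> / \<tau>"
proof (rule total_variation_le_one_sided)
  have pos: "\<tau> > 0" using assms by simp
  show P: "prob_space (gaussian \<mu> \<sigma>)" "prob_space (gaussian \<mu> \<tau>)"
    using assms pos by (auto intro: prob_space_gaussian)
  \<comment> \<open>The factor \<open>\<sigma> / \<tau>\<close> equalises the normalising constants,
    leaving only the exponents to compare.\<close>
  have le: "\<sigma> / \<tau> * normal_density \<mu> \<sigma> x \<le> normal_density \<mu> \<tau> x" for x
  proof -
    have "\<sigma> / \<tau> * normal_density \<mu> \<sigma> x = exp (- (x - \<mu>)\<^sup>2 / (2 * \<sigma>\<^sup>2)) / (sqrt (2 * pi) * \<tau>)"
      using assms by (simp add: normal_density_def real_sqrt_mult)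
    also have "\<dots> \<le> exp (- (x - \<mu>)\<^sup>2 / (2 * \<tau>\<^sup>2)) / (sqrt (2 * pi) * \<tau>)"
      using assms pos by (intro divide_right_mono) (auto intro!: divide_left_mono power_mono)
    also have "\<dots> = normal_density \<mu> \<tau> x"
      using pos by (simp add: normal_density_def real_sqrt_mult)
    finally show ?thesis .
  qed
  fix A :: "real set" assume A: "A \<in> sets borel"
  have "\<sigma> / \<tau> * measure (gaussian \<mu> \<sigma>) A \<le> measure (gaussian \<mu> \<tau>) A"
    using assms pos A le by (intro measure_gaussian_mono) auto
  then have "measure (gaussian \<mu> \<sigma>) A - measure (gaussian \<mu> \<tau>) A
      \<le> (1 - \<sigma> / \<tau>) * measure (gaussian \<mu> \<sigma>) A"
    by (simp add: algebra_simps)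
  also have "\<dots> \<le> 1 - \<sigma> / \<tau>"
    using assms pos prob_space.prob_le_1[OF P(1), of A] by (intro mult_left_le) auto
  finally show "measure (gaussian \<mu> \<sigma>) A - measure (gaussian \<mu> \<tau>) A \<le> 1 - \<sigma> / \<tau>" .
qed simp_all

lemma total_variation_gaussian_le_variance:
  assumes "\<sigma>\<^sub>1 > 0" "\<sigma>\<^sub>2 > 0"
  shows "total_variation (gaussian \<mu> \<sigma>\<^sub>1) (gaussian \<mu> \<sigma>\<^sub>2) \<le> \<bar>\<sigma>\<^sub>1\<^sup>2 - \<sigma>\<^sub>2\<^sup>2\<bar> / \<sigma>\<^sub>1\<^sup>2"
proof -
  define s where "s = \<sigma>\<^sub>2 / \<sigma>\<^sub>1"
  have s: "s > 0" using assms by (simp add: s_def)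
  have "(\<sigma>\<^sub>1\<^sup>2 - \<sigma>\<^sub>2\<^sup>2) / \<sigma>\<^sub>1\<^sup>2 = 1 - s\<^sup>2"
    using assms by (simp add: s_def field_simps)
  then have eq: "\<bar>\<sigma>\<^sub>1\<^sup>2 - \<sigma>\<^sub>2\<^sup>2\<bar> / \<sigma>\<^sub>1\<^sup>2 = \<bar>1 - s\<^sup>2\<bar>"
    by (metis abs_divide abs_power2)
  \<comment> \<open>The bound in terms of standard deviations passes to variances because
    \<open>1 + s\<close> is at least 1.\<close>
  have "\<bar>1 - s\<bar> * 1 \<le> \<bar>1 - s\<bar> * (1 + s)"
    using s by (intro mult_left_mono) auto
  also have "\<dots> = \<bar>(1 - s) * (1 + s)\<bar>"
    unfolding abs_mult using s by simp
  also have "(1 - s) * (1 + s) = 1 - s\<^sup>2"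
    by (simp add: power2_eq_square algebra_simps)
  finally have le: "\<bar>1 - s\<bar> \<le> \<bar>1 - s\<^sup>2\<bar>" by simp
  show ?thesis
  proof (cases "\<sigma>\<^sub>1 \<le> \<sigma>\<^sub>2")
    case True
    then have s1: "s \<ge> 1" using assms by (simp add: s_def)
    have "1 - 1 / s = (s - 1) / s"
      using s by (simp add: diff_divide_distrib)
    also have "\<dots> \<le> (s - 1) / 1"
      using s1 by (intro divide_left_mono) auto
    finally have "1 - 1 / s \<le> \<bar>1 - s\<bar>" by simp
    moreover have "1 / s = \<sigma>\<^sub>1 / \<sigma>\<^sub>2" by (simp add: s_def)
    ultimately show ?thesis
      unfolding eq using total_variation_gaussian_le_sd[OF assms(1) True, of \<mu>] le by linarith
  next
    case False
    then have "total_variation (gaussian \<mu> \<sigma>\<^sub>2) (gaussian \<mu> \<sigma>\<^sub>1) \<le> 1 - s"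
      unfolding s_def using assms by (intro total_variation_gaussian_le_sd) auto
    then show ?thesis
      unfolding eq total_variation_commute[of "gaussian \<mu> \<sigma>\<^sub>1"] using le by linarith
  qed
qed

text \<open>With a common variance the normalising constants cancel and \<open>exp\<close> is
  monotone, so the nearer mean has the larger density.\<close>

lemma normal_density_le_iff:
  assumes "\<sigma> > 0"
  shows "normal_density \<mu> \<sigma> x \<le> normal_density \<nu> \<sigma> x \<longleftrightarrow> \<bar>x - \<nu>\<bar> \<le> \<bar>x - \<mu>\<bar>"
  using assms by (simp add: normal_density_def divide_le_cancel mult_le_cancel_left mult_less_0_iff
      abs_le_square_iff)

lemma total_variation_gaussian_le_mean_ordered:
  assumes "\<sigma> > 0" "\<mu> \<le> \<nu>"
  shows "total_variation (gaussian \<mu> \<sigma>) (gaussian \<nu> \<sigma>) \<le> (\<nu> - \<mu>) / (2 * \<sigma>)"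
proof (rule total_variation_le_one_sided)
  let ?P = "gaussian \<mu> \<sigma>" and ?Q = "gaussian \<nu> \<sigma>"
  define m where "m = (\<mu> + \<nu>) / 2"
  let ?H = "{..m}"
  interpret P: prob_space ?P using assms by (intro prob_space_gaussian)
  interpret Q: prob_space ?Q using assms by (intro prob_space_gaussian)
  show "prob_space ?P" "prob_space ?Q" by unfold_locales
  have left: "measure ?Q B \<le> measure ?P B" if "B \<in> sets borel" "B \<subseteq> ?H" for B
    using that assms(2) measure_gaussian_mono[OF assms(1,1), of 1 B \<nu> \<mu>]
    by (force simp: normal_density_le_iff[OF assms(1)] m_def)
  have right: "measure ?P B \<le> measure ?Q B" if "B \<in> sets borel" "B \<inter> ?H = {}" for B
    using that assms(2) measure_gaussian_mono[OF assms(1,1), of 1 B \<mu> \<nu>]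
    by (force simp: normal_density_le_iff[OF assms(1)] m_def)
  fix A :: "real set" assume A: "A \<in> sets borel"
  \<comment> \<open>Splitting \<open>A\<close> and \<open>?H\<close> along each other shows that
    replacing \<open>A\<close> by \<open>?H\<close> drops \<open>A - ?H\<close>, where
    \<open>?Q\<close> has at least as much mass, and adds \<open>?H - A\<close>, where
    \<open>?P\<close> does. Neither change lowers the difference.\<close>
  have "measure ?P A = measure ?P (A \<inter> ?H) + measure ?P (A - ?H)"
    using A by (subst P.finite_measure_Union[symmetric]) (auto intro!: arg_cong[where f = "measure ?P"])
  moreover have "measure ?Q A = measure ?Q (A \<inter> ?H) + measure ?Q (A - ?H)"
    using A by (subst Q.finite_measure_Union[symmetric]) (auto intro!: arg_cong[where f = "measure ?Q"])
  moreover have "measure ?P ?H = measure ?P (A \<inter> ?H) + measure ?P (?H - A)"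
    using A by (subst P.finite_measure_Union[symmetric]) (auto intro!: arg_cong[where f = "measure ?P"])
  moreover have "measure ?Q ?H = measure ?Q (A \<inter> ?H) + measure ?Q (?H - A)"
    using A by (subst Q.finite_measure_Union[symmetric]) (auto intro!: arg_cong[where f = "measure ?Q"])
  moreover have "measure ?Q (?H - A) \<le> measure ?P (?H - A)"
    using A by (intro left) auto
  moreover have "measure ?P (A - ?H) \<le> measure ?Q (A - ?H)"
    using A by (intro right) auto
  ultimately have "measure ?P A - measure ?Q A \<le> measure ?P ?H - measure ?Q ?H"
    by linarith
  also have "\<dots> = \<Phi> ((m - \<mu>) / \<sigma>) - \<Phi> ((m - \<nu>) / \<sigma>)"
    using cdf_gaussian[OF assms(1), of \<mu> m] cdf_gaussian[OF assms(1), of \<nu> m]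
    by (simp add: cdf_def)
  \<comment> \<open>The two arguments are symmetric about 0, at distance
    \<open>(\<nu> - \<mu>) / \<sigma>\<close> from each other.\<close>
  also have "\<dots> \<le> ((m - \<mu>) / \<sigma> - (m - \<nu>) / \<sigma>) / 2"
    using assms by (intro std_normal_cdf_diff_le divide_right_mono) auto
  also have "\<dots> = (\<nu> - \<mu>) / (2 * \<sigma>)"
    by (simp flip: diff_divide_distrib)
  finally show "measure ?P A - measure ?Q A \<le> (\<nu> - \<mu>) / (2 * \<sigma>)" .
qed simp_all

lemma total_variation_gaussian_le_mean:
  assumes "\<sigma> > 0"
  shows "total_variation (gaussian \<mu> \<sigma>) (gaussian \<nu> \<sigma>) \<le> \<bar>\<mu> - \<nu>\<bar> / (2 * \<sigma>)"
  using total_variation_gaussian_le_mean_ordered[OF assms, of \<mu> \<nu>]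
    total_variation_gaussian_le_mean_ordered[OF assms, of \<nu> \<mu>]
    total_variation_commute[of "gaussian \<mu> \<sigma>" "gaussian \<nu> \<sigma>"]
  by (cases "\<mu> \<le> \<nu>") simp_all

section \<open>Combining the bounds\<close>

theorem theorem1p3:
  fixes \<mu>\<^sub>1 \<mu>\<^sub>2 \<sigma>\<^sub>1 \<sigma>\<^sub>2 :: real
  assumes "\<sigma>\<^sub>1 > 0" and "\<sigma>\<^sub>2 > 0"
  shows "1 / 200 * min 1 (max (\<bar>\<sigma>\<^sub>1\<^sup>2 - \<sigma>\<^sub>2\<^sup>2\<bar> / \<sigma>\<^sub>1\<^sup>2) (40 * \<bar>\<mu>\<^sub>1 - \<mu>\<^sub>2\<bar> / \<sigma>\<^sub>1))
           \<le> total_variation (gaussian \<mu>\<^sub>1 \<sigma>\<^sub>1) (gaussian \<mu>\<^sub>2 \<sigma>\<^sub>2)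
       \<and> total_variation (gaussian \<mu>\<^sub>1 \<sigma>\<^sub>1) (gaussian \<mu>\<^sub>2 \<sigma>\<^sub>2)
           \<le> 3 * \<bar>\<sigma>\<^sub>1\<^sup>2 - \<sigma>\<^sub>2\<^sup>2\<bar> / (2 * \<sigma>\<^sub>1\<^sup>2) + \<bar>\<mu>\<^sub>1 - \<mu>\<^sub>2\<bar> / (2 * \<sigma>\<^sub>1)"
proof
  define r where "r = \<bar>\<sigma>\<^sub>1\<^sup>2 - \<sigma>\<^sub>2\<^sup>2\<bar> / \<sigma>\<^sub>1\<^sup>2"
  define d where "d = \<bar>\<mu>\<^sub>1 - \<mu>\<^sub>2\<bar> / \<sigma>\<^sub>1"
  have nonneg: "r \<ge> 0" "d \<ge> 0" using assms by (simp_all add: r_def d_def)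
  let ?TV = "total_variation (gaussian \<mu>\<^sub>1 \<sigma>\<^sub>1) (gaussian \<mu>\<^sub>2 \<sigma>\<^sub>2)"
  \<comment> \<open>The constant 40 matches the slope 1/5, since 40/200 = 1/5; once \<open>d\<close>
    reaches 1/40 the left side is capped at 1/200. The variance term has room to spare, as 1/30
    exceeds 1/200.\<close>
  have "1 / 200 * min 1 (max r (40 * d)) \<le> ?TV"
    using total_variation_gaussian_ge_variance[OF assms, of \<mu>\<^sub>1 \<mu>\<^sub>2, folded r_def]
      total_variation_gaussian_ge_mean[OF assms, of \<mu>\<^sub>1 \<mu>\<^sub>2, folded d_def] nonneg
    by (auto simp: min_def max_def split: if_splits)
  then show "1 / 200 * min 1 (max (\<bar>\<sigma>\<^sub>1\<^sup>2 - \<sigma>\<^sub>2\<^sup>2\<bar> / \<sigma>\<^sub>1\<^sup>2) (40 * \<bar>\<mu>\<^sub>1 - \<mu>\<^sub>2\<bar> / \<sigma>\<^sub>1)) \<le> ?TV"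
    by (simp add: r_def d_def)
  \<comment> \<open>Changing the mean first, while the standard deviation is still
    \<open>\<sigma>\<^sub>1\<close>, puts \<open>\<sigma>\<^sub>1\<close> in the denominator of the
    mean term.\<close>
  have "?TV \<le> total_variation (gaussian \<mu>\<^sub>1 \<sigma>\<^sub>1) (gaussian \<mu>\<^sub>2 \<sigma>\<^sub>1)
      + total_variation (gaussian \<mu>\<^sub>2 \<sigma>\<^sub>1) (gaussian \<mu>\<^sub>2 \<sigma>\<^sub>2)"
    using assms by (intro total_variation_triangle prob_space_gaussian)
  also have "\<dots> \<le> d / 2 + r"
    using total_variation_gaussian_le_mean[OF assms(1), of \<mu>\<^sub>1 \<mu>\<^sub>2]
      total_variation_gaussian_le_variance[OF assms, of \<mu>\<^sub>2]
    by (simp add: d_def r_def mult.commute)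
  \<comment> \<open>The argument yields coefficient 1 for the variance term, which is relaxed to
    3/2.\<close>
  also have "\<dots> \<le> 3 * r / 2 + d / 2" using nonneg by simp
  finally show "?TV \<le> 3 * \<bar>\<sigma>\<^sub>1\<^sup>2 - \<sigma>\<^sub>2\<^sup>2\<bar> / (2 * \<sigma>\<^sub>1\<^sup>2) + \<bar>\<mu>\<^sub>1 - \<mu>\<^sub>2\<bar> / (2 * \<sigma>\<^sub>1)"
    by (simp add: r_def d_def mult.commute)
qed

end
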